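(* Let $p$ be a probability distribution on $\mathbb{R}^D$, let $x\in\mathbb{R}^D$ be fixed, and let $y,y_1,y_2,\dots$ be i.i.d. with distribution $p$. Let $w=k(x,y)$, and assume that for some constants $M,C>0$ one has $w\in[0,M]$ and $\|y\|\le C$ almost surely, that $\Pr(w>0)=1$, and that $\mathbb{E}[w]>0$. Let $T^*=\mathbb{E}[wy]/\mathbb{E}[w]$ be the target centroid and $T_n$ the minibatch centroid of $y_1,\dots,y_n$. Then, as $n\to\infty$, $$\mathbb{E}[T_n]-T^* \;=\; -\,\frac{1}{n}\,\frac{\mathbb{E}\bigl[w^2\,(y-T^* )\bigr]}{(\mathbb{E}[w])^2}\;+\;O(n^{-2}).$$
   Context: $k:\mathbb{R}^D\times\mathbb{R}^D\to\mathbb{R}$ is a kernel (with $k(x,\cdot)$ measurable), and $\|\cdot\|$ is the Euclidean norm. With $w_i=k(x,y_i)$, the minibatch centroid is $T_n:=\sum_{i=1}^n\alpha_i y_i$ with $\alpha_i=w_i/\sum_{j=1}^n w_j$; it is well defined on the event $\sum_{j=1}^n w_j>0$, which has probability one under the hypotheses. The distribution $p$, kernel $k$ and query $x$ do not depend on $n$; $O(n^{-2})$ denotes a vector in $\mathbb{R}^D$ whose norm is at most a constant (independent of $n$) times $n^{-2}$ for all sufficiently large $n$. *)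

theory Defs
  imports "HOL-Probability.Probability" "HOL-Library.Landau_Symbols"
begin

(* The samples are ys 1, ..., ys n. If all weights vanish, division by zero makes the value 0. *)
definition minibatch_centroid ::
  "('a \<Rightarrow> 'a \<Rightarrow> real) \<Rightarrow> 'a \<Rightarrow> (nat \<Rightarrow> 'a) \<Rightarrow> nat \<Rightarrow> 'a :: real_vector"
where
  "minibatch_centroid k x ys n =
     (\<Sum>i=1..n. (k x (ys i) / (\<Sum>j=1..n. k x (ys j))) *\<^sub>R ys i)"

definition target_centroid ::
  "'w measure \<Rightarrow> ('a \<Rightarrow> 'a \<Rightarrow> real) \<Rightarrow> 'a \<Rightarrow> ('w \<Rightarrow> 'a) \<Rightarrow> 'a :: {banach, second_countable_topology}"
where
  "target_centroid P k x y =
     (\<integral>\<omega>. k x (y \<omega>) *\<^sub>R y \<omega> \<partial>P) /\<^sub>R (\<integral>\<omega>. k x (y \<omega>) \<partial>P)"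

end

theory Submission
  imports Defs
begin

text \<open>
  Put \<open>\<mu> = E w\<close>, \<open>A = \<Sum> w\<^sub>i (y\<^sub>i - T\<^sup>*)\<close> and \<open>B = \<Sum> (w\<^sub>i - \<mu>)\<close>, so that \<open>T\<^sub>n - T\<^sup>* = A / (n\<mu> + B)\<close>
  almost surely, where \<open>A\<close> and \<open>B\<close> are sums of bounded centered i.i.d. terms. Expanding the quotient
  to fourth order in \<open>B\<close> leaves the remainder \<open>(T\<^sub>n - T\<^sup>*) B\<^sup>4 / (n\<mu>)\<^sup>4\<close>. Since \<open>T\<^sub>n\<close> is a convex
  combination of the samples, its first factor is bounded, so the fourth moment bound \<open>E B\<^sup>4 = O(n\<^sup>2)\<close>
  suffices and no lower tail estimate for \<open>\<Sum> w\<^sub>i\<close> is needed. The remaining terms have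
  \<open>E A = 0\<close>, \<open>E[A B] = n E[w\<^sup>2 (y - T\<^sup>*)]\<close>, \<open>E[A B\<^sup>2] = O(n)\<close> and \<open>E[A B\<^sup>3] = O(n\<^sup>2)\<close>.
\<close>

text \<open>Replacing the factor of smaller absolute value by the larger one gives a pure fourth
  power. This crude form of Young's inequality reduces the mixed moment of \<open>A\<close> and
  \<open>B ^ 3\<close> to two pure fourth moments.\<close>

lemma abs_mult_cube_le: "\<bar>u * v ^ 3\<bar> \<le> u ^ 4 + v ^ 4" for u v :: real
proof (cases "\<bar>u\<bar> \<le> \<bar>v\<bar>")
  case True
  then have "\<bar>u\<bar> * \<bar>v\<bar> ^ 3 \<le> \<bar>v\<bar> * \<bar>v\<bar> ^ 3" by (intro mult_right_mono) auto
  also have "\<dots> = v ^ 4" by (simp flip: power_Suc)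
  finally show ?thesis by (simp add: abs_mult power_abs add_increasing)
next
  case False
  then have "\<bar>u\<bar> * \<bar>v\<bar> ^ 3 \<le> \<bar>u\<bar> * \<bar>u\<bar> ^ 3" by (intro mult_left_mono power_mono) auto
  also have "\<dots> = u ^ 4" by (simp flip: power_Suc)
  finally show ?thesis by (simp add: abs_mult power_abs add_increasing2)
qed

section \<open>Essentially bounded random variables and independence of sums\<close>

context prob_space
begin

text \<open>On a probability space this class is closed under the ring operations and consists of
  integrable functions, so integrability of any polynomial in bounded variables follows by
  introduction rules. The bound is existential because its value is irrelevant for that
  purpose.\<close>

definition ess_bounded :: "('a \<Rightarrow> real) \<Rightarrow> bool" where
  "ess_bounded f \<longleftrightarrow> f \<in> borel_measurable M \<and> (\<exists>c. AE \<omega> in M. \<bar>f \<omega>\<bar> \<le> c)"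

lemma ess_boundedI: "f \<in> borel_measurable M \<Longrightarrow> AE \<omega> in M. \<bar>f \<omega>\<bar> \<le> c \<Longrightarrow> ess_bounded f"
  by (auto simp: ess_bounded_def)

lemma ess_bounded_integrable: "ess_bounded f \<Longrightarrow> integrable M f"
  unfolding ess_bounded_def real_norm_def[symmetric] by (blast intro: integrable_const_bound)

lemma ess_bounded_const: "ess_bounded (\<lambda>_. c)"
  by (auto simp: ess_bounded_def)

lemma ess_bounded_add:
  assumes "ess_bounded f" "ess_bounded g" shows "ess_bounded (\<lambda>\<omega>. f \<omega> + g \<omega>)"
proof -
  from assms obtain c d where "AE \<omega> in M. \<bar>f \<omega>\<bar> \<le> c" "AE \<omega> in M. \<bar>g \<omega>\<bar> \<le> d"
    by (auto simp: ess_bounded_def)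
  then have "AE \<omega> in M. \<bar>f \<omega> + g \<omega>\<bar> \<le> c + d"
    by eventually_elim linarith
  then show ?thesis
    using assms by (auto simp: ess_bounded_def)
qed

lemma ess_bounded_mult:
  assumes "ess_bounded f" "ess_bounded g" shows "ess_bounded (\<lambda>\<omega>. f \<omega> * g \<omega>)"
proof -
  from assms obtain c d where "AE \<omega> in M. \<bar>f \<omega>\<bar> \<le> c" "AE \<omega> in M. \<bar>g \<omega>\<bar> \<le> d"
    by (auto simp: ess_bounded_def)
  then have "AE \<omega> in M. \<bar>f \<omega> * g \<omega>\<bar> \<le> c * d"
    by eventually_elim (auto simp: abs_mult intro!: mult_mono)
  then show ?thesis
    using assms by (auto simp: ess_bounded_def)
qed

lemma ess_bounded_diff:
  "ess_bounded f \<Longrightarrow> ess_bounded g \<Longrightarrow> ess_bounded (\<lambda>\<omega>. f \<omega> - g \<omega>)"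
  using ess_bounded_add[OF _ ess_bounded_mult[OF ess_bounded_const[of "-1"]], of f g] by simp

lemma ess_bounded_power: "ess_bounded f \<Longrightarrow> ess_bounded (\<lambda>\<omega>. f \<omega> ^ n)"
  by (induction n) (auto intro: ess_bounded_const ess_bounded_mult)

lemma ess_bounded_sum:
  "(\<And>i. i \<in> I \<Longrightarrow> ess_bounded (f i)) \<Longrightarrow> ess_bounded (\<lambda>\<omega>. \<Sum>i\<in>I. f i \<omega>)"
  by (induction I rule: infinite_finite_induct) (auto intro: ess_bounded_const ess_bounded_add)

lemmas ess_bounded_intros =
  ess_bounded_const ess_bounded_add ess_bounded_mult ess_bounded_diff ess_bounded_power ess_bounded_sum

lemma expectation_abs_le:
  assumes "ess_bounded f" "AE \<omega> in M. \<bar>f \<omega>\<bar> \<le> c"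
  shows "\<bar>expectation f\<bar> \<le> c"
proof -
  have "\<bar>expectation f\<bar> \<le> expectation (\<lambda>\<omega>. \<bar>f \<omega>\<bar>)"
    by (rule integral_abs_bound)
  also have "\<dots> \<le> expectation (\<lambda>_. c)"
    using assms by (intro integral_mono_AE integrable_abs ess_bounded_integrable ess_bounded_const) auto
  finally show ?thesis by (simp add: prob_space)
qed

text \<open>Turns an almost sure constraint \<open>Q\<close> on \<open>X\<close> into integrability
  of every Borel function of \<open>X\<close> that is bounded where \<open>Q\<close> holds.\<close>

lemma integrable_compose_bounded:
  fixes f :: "'b :: topological_space \<Rightarrow> 'c :: {banach, second_countable_topology}"
  assumes "AE \<omega> in M. Q (X \<omega>)" and "X \<in> borel_measurable M" and "f \<in> borel_measurable borel"
    and "\<And>v. Q v \<Longrightarrow> norm (f v) \<le> D"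
  shows "integrable M (\<lambda>\<omega>. f (X \<omega>))"
  using assms by (intro integrable_const_bound[where B = D]) (auto elim!: eventually_mono)

text \<open>The sum is a measurable function of the subfamily over \<open>I\<close>, which is
  disjoint from \<open>{i}\<close>. The general codomain admits real pairs, so that two partial sums
  can be treated jointly.\<close>

lemma indep_var_sum:
  fixes X :: "'i \<Rightarrow> 'a \<Rightarrow> 'b :: {second_countable_topology, topological_comm_monoid_add}"
  assumes "finite I" "i \<notin> I" and indep: "indep_vars (\<lambda>_. borel) X (insert i I)"
  shows "indep_var borel (X i) borel (\<lambda>\<omega>. \<Sum>j\<in>I. X j \<omega>)"
proof -
  have "indep_var borel ((\<lambda>f. f i) \<circ> (\<lambda>\<omega>. \<lambda>j\<in>{i}. X j \<omega>)) borel ((\<lambda>f. \<Sum>j\<in>I. f j) \<circ> (\<lambda>\<omega>. \<lambda>j\<in>I. X j \<omega>))"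
    using assms by (intro indep_var_compose[OF indep_var_restrict[OF indep]]) auto
  then show ?thesis by (simp add: comp_def)
qed

end

text \<open>Abstract setting for one coordinate of the centroid: \<open>a\<close> stands for the
  weighted deviation from the target, \<open>b\<close> for the centered weight. Independence is
  between pairs; within a pair the two entries are correlated, with covariance \<open>c\<close>. Of
  identical distribution only the common \<open>K\<close> and \<open>c\<close> are retained.\<close>

locale centered_indep_pairs = prob_space +
  fixes a b :: "nat \<Rightarrow> 'a \<Rightarrow> real" and c K :: real
  assumes indep: "indep_vars (\<lambda>_. borel) (\<lambda>i \<omega>. (a i \<omega>, b i \<omega>)) UNIV"
    and a_le: "\<And>i. AE \<omega> in M. \<bar>a i \<omega>\<bar> \<le> K"
    and b_le: "\<And>i. AE \<omega> in M. \<bar>b i \<omega>\<bar> \<le> K"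
    and mean_a: "\<And>i. expectation (a i) = 0"
    and mean_b: "\<And>i. expectation (b i) = 0"
    and cov: "\<And>i. expectation (\<lambda>\<omega>. a i \<omega> * b i \<omega>) = c"
begin

section \<open>Partial sums of the pairs and their moments\<close>

definition A :: "nat \<Rightarrow> 'a \<Rightarrow> real" where "A n \<omega> = (\<Sum>i=1..n. a i \<omega>)"
definition B :: "nat \<Rightarrow> 'a \<Rightarrow> real" where "B n \<omega> = (\<Sum>i=1..n. b i \<omega>)"

lemma A_Suc: "A (Suc n) \<omega> = A n \<omega> + a (Suc n) \<omega>"
  and B_Suc: "B (Suc n) \<omega> = B n \<omega> + b (Suc n) \<omega>"
  by (simp_all add: A_def B_def)

lemma pair_measurable: "(\<lambda>\<omega>. (a i \<omega>, b i \<omega>)) \<in> borel_measurable M"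
  using indep by (auto simp: indep_vars_def)

lemma measurable_a: "a i \<in> borel_measurable M"
  and measurable_b: "b i \<in> borel_measurable M"
  using measurable_compose[OF pair_measurable[of i] borel_measurable_continuous_onI[of fst]]
        measurable_compose[OF pair_measurable[of i] borel_measurable_continuous_onI[of snd]]
  by (auto simp: continuous_on_fst continuous_on_snd continuous_on_id)

lemma ess_bounded_a: "ess_bounded (a i)"
  using measurable_a a_le by (rule ess_boundedI)

lemma ess_bounded_b: "ess_bounded (b i)"
  using measurable_b b_le by (rule ess_boundedI)

lemma ess_bounded_A: "ess_bounded (A n)"
  unfolding A_def by (intro ess_bounded_intros ess_bounded_a)

lemma ess_bounded_B: "ess_bounded (B n)"
  unfolding B_def by (intro ess_bounded_intros ess_bounded_b)

lemmas bounded = ess_bounded_intros ess_bounded_A ess_bounded_B ess_bounded_a ess_bounded_b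
lemmas integ = ess_bounded_integrable

lemma K_nonneg: "0 \<le> K"
proof -
  from a_le[of 0] have "AE \<omega> in M. 0 \<le> K" by eventually_elim linarith
  then show ?thesis by simp
qed

text \<open>\<open>A n\<close> and \<open>B n\<close> are functions of the first \<open>n\<close>
  pairs, hence jointly independent of the next pair. Free exponents let this one factorization treat
  every cross term in the inductions below; such a term vanishes as soon as one factor is
  centered.\<close>

lemma moment_Suc:
  "expectation (\<lambda>\<omega>. (A n \<omega> ^ p * B n \<omega> ^ q) * (a (Suc n) \<omega> ^ r * b (Suc n) \<omega> ^ s)) =
   expectation (\<lambda>\<omega>. A n \<omega> ^ p * B n \<omega> ^ q) * expectation (\<lambda>\<omega>. a (Suc n) \<omega> ^ r * b (Suc n) \<omega> ^ s)"
proof -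
  let ?X = "\<lambda>i \<omega>. (a i \<omega>, b i \<omega>)"
  have "indep_var borel (?X (Suc n)) borel (\<lambda>\<omega>. \<Sum>i\<in>{1..n}. ?X i \<omega>)"
    by (rule indep_var_sum) (auto intro: indep_vars_subset[OF indep])
  then have "indep_var borel ((\<lambda>z. fst z ^ r * snd z ^ s) \<circ> (?X (Suc n)))
      borel ((\<lambda>z. fst z ^ p * snd z ^ q) \<circ> (\<lambda>\<omega>. \<Sum>i\<in>{1..n}. ?X i \<omega>))"
    by (rule indep_var_compose) (auto intro!: borel_measurable_continuous_onI continuous_intros)
  moreover have "(\<Sum>i\<in>{1..n}. ?X i \<omega>) = (A n \<omega>, B n \<omega>)" for \<omega>
    by (simp add: A_def B_def prod_eq_iff fst_sum snd_sum)
  ultimately have ind: "indep_var borel (\<lambda>\<omega>. a (Suc n) \<omega> ^ r * b (Suc n) \<omega> ^ s)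
      borel (\<lambda>\<omega>. A n \<omega> ^ p * B n \<omega> ^ q)"
    by (simp add: comp_def)
  show ?thesis
    using indep_var_lebesgue_integral[OF ind integ integ]
    by (simp add: mult.commute bounded)
qed

lemma mean_A: "expectation (A n) = 0"
  unfolding A_def by (subst Bochner_Integration.integral_sum) (auto simp: mean_a intro!: integ bounded)

lemma mean_B: "expectation (B n) = 0"
  unfolding B_def by (subst Bochner_Integration.integral_sum) (auto simp: mean_b intro!: integ bounded)

lemma expectation_AB: "expectation (\<lambda>\<omega>. A n \<omega> * B n \<omega>) = real n * c"
proof (induction n)
  case 0
  then show ?case by (simp add: A_def)
next
  case (Suc n)
  have "(\<lambda>\<omega>. A (Suc n) \<omega> * B (Suc n) \<omega>) = (\<lambda>\<omega>. A n \<omega> * B n \<omega>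
      + A n \<omega> * b (Suc n) \<omega> + B n \<omega> * a (Suc n) \<omega> + a (Suc n) \<omega> * b (Suc n) \<omega>)"
    by (simp add: A_Suc B_Suc algebra_simps)
  moreover have "expectation (\<lambda>\<omega>. A n \<omega> * b (Suc n) \<omega>) = 0"
    using moment_Suc[of n 1 0 0 1] by (simp add: mean_A)
  moreover have "expectation (\<lambda>\<omega>. B n \<omega> * a (Suc n) \<omega>) = 0"
    using moment_Suc[of n 0 1 1 0] by (simp add: mean_B)
  ultimately show ?case
    using Suc by (simp add: integ bounded cov algebra_simps)
qed

lemma abs_monomial_le:
  "\<bar>expectation (\<lambda>\<omega>. a i \<omega> ^ r * b i \<omega> ^ s)\<bar> \<le> K ^ (r + s)"
proof (intro expectation_abs_le bounded)
  show "AE \<omega> in M. \<bar>a i \<omega> ^ r * b i \<omega> ^ s\<bar> \<le> K ^ (r + s)"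
    using a_le[of i] b_le[of i]
  proof eventually_elim
    case (elim \<omega>)
    then show ?case
      using K_nonneg by (auto simp: abs_mult power_abs power_add intro!: mult_mono power_mono)
  qed
qed

lemma expectation_B2: "expectation (\<lambda>\<omega>. B n \<omega> ^ 2) \<le> real n * K ^ 2"
proof (induction n)
  case 0
  then show ?case by (simp add: B_def)
next
  case (Suc n)
  have eq: "(\<lambda>\<omega>. B (Suc n) \<omega> ^ 2) = (\<lambda>\<omega>. B n \<omega> ^ 2 + 2 * (B n \<omega> * b (Suc n) \<omega>) + b (Suc n) \<omega> ^ 2)"
    by (simp add: B_Suc algebra_simps power2_eq_square)
  have "expectation (\<lambda>\<omega>. B n \<omega> * b (Suc n) \<omega>) = 0"
    using moment_Suc[of n 0 1 0 1] by (simp add: mean_B)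
  moreover have "\<bar>expectation (\<lambda>\<omega>. b (Suc n) \<omega> ^ 2)\<bar> \<le> K ^ 2"
    using abs_monomial_le[of "Suc n" 0 2] by (simp only: power_0 mult_1 add_0)
  ultimately show ?case
    unfolding eq using Suc by (simp add: integ bounded algebra_simps)
qed

text \<open>In the increment every cross term has a factor of mean zero, so only the third moment of
  the new pair survives and growth is linear. Cauchy-Schwarz would give only order \<open>n\<close>
  to the power 3/2, too weak after division by the cube of \<open>n\<close>.\<close>

lemma expectation_AB2: "\<bar>expectation (\<lambda>\<omega>. A n \<omega> * B n \<omega> ^ 2)\<bar> \<le> real n * K ^ 3"
proof (induction n)
  case 0
  then show ?case by (simp add: A_def)
next
  case (Suc n)
  have eq: "(\<lambda>\<omega>. A (Suc n) \<omega> * B (Suc n) \<omega> ^ 2) = (\<lambda>\<omega>. A n \<omega> * B n \<omega> ^ 2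
      + 2 * (A n \<omega> * B n \<omega> * b (Suc n) \<omega>) + A n \<omega> * b (Suc n) \<omega> ^ 2
      + B n \<omega> ^ 2 * a (Suc n) \<omega> + 2 * (B n \<omega> * (a (Suc n) \<omega> * b (Suc n) \<omega>))
      + a (Suc n) \<omega> * b (Suc n) \<omega> ^ 2)"
    by (simp add: A_Suc B_Suc algebra_simps power2_eq_square)
  have "expectation (\<lambda>\<omega>. A n \<omega> * B n \<omega> * b (Suc n) \<omega>) = 0"
    using moment_Suc[of n 1 1 0 1] by (simp add: mean_b)
  moreover have "expectation (\<lambda>\<omega>. A n \<omega> * b (Suc n) \<omega> ^ 2) = 0"
    using moment_Suc[of n 1 0 0 2] by (simp add: mean_A)
  moreover have "expectation (\<lambda>\<omega>. B n \<omega> ^ 2 * a (Suc n) \<omega>) = 0"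
    using moment_Suc[of n 0 2 1 0] by (simp add: mean_a)
  moreover have "expectation (\<lambda>\<omega>. B n \<omega> * (a (Suc n) \<omega> * b (Suc n) \<omega>)) = 0"
    using moment_Suc[of n 0 1 1 1] by (simp add: mean_B)
  moreover have "\<bar>expectation (\<lambda>\<omega>. a (Suc n) \<omega> * b (Suc n) \<omega> ^ 2)\<bar> \<le> K ^ 3"
    using abs_monomial_le[of "Suc n" 1 2] by (simp add: numeral_3_eq_3)
  ultimately show ?case
    unfolding eq using Suc by (simp add: integ bounded algebra_simps)
qed

text \<open>The odd cross terms vanish. The one that remains, 6 times the product of two second
  moments, is at most \<open>6 * n * K ^ 4\<close>, which sums to quadratic growth.\<close>

lemma expectation_B4: "expectation (\<lambda>\<omega>. B n \<omega> ^ 4) \<le> 3 * K ^ 4 * real n ^ 2"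
proof (induction n)
  case 0
  then show ?case by (simp add: B_def)
next
  case (Suc n)
  have eq: "(\<lambda>\<omega>. B (Suc n) \<omega> ^ 4) = (\<lambda>\<omega>. B n \<omega> ^ 4 + 4 * (B n \<omega> ^ 3 * b (Suc n) \<omega>)
      + 6 * (B n \<omega> ^ 2 * b (Suc n) \<omega> ^ 2) + 4 * (B n \<omega> * b (Suc n) \<omega> ^ 3) + b (Suc n) \<omega> ^ 4)"
    by (simp add: B_Suc algebra_simps power4_eq_xxxx power3_eq_cube power2_eq_square)
  have "expectation (\<lambda>\<omega>. B n \<omega> ^ 3 * b (Suc n) \<omega>) = 0"
    using moment_Suc[of n 0 3 0 1] by (simp add: mean_b)
  moreover have "expectation (\<lambda>\<omega>. B n \<omega> * b (Suc n) \<omega> ^ 3) = 0"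
    using moment_Suc[of n 0 1 0 3] by (simp add: mean_B)
  moreover have "expectation (\<lambda>\<omega>. B n \<omega> ^ 2 * b (Suc n) \<omega> ^ 2) \<le> real n * K ^ 4"
  proof -
    have "expectation (\<lambda>\<omega>. B n \<omega> ^ 2) * expectation (\<lambda>\<omega>. b (Suc n) \<omega> ^ 2) \<le> (real n * K ^ 2) * K ^ 2"
      using expectation_B2 abs_monomial_le[of "Suc n" 0 2] K_nonneg
      by (intro mult_mono) (auto simp: abs_le_iff numeral_2_eq_2)
    then show ?thesis
      using moment_Suc[of n 0 2 0 2] by (simp add: power_add[symmetric] mult.assoc)
  qed
  moreover have "expectation (\<lambda>\<omega>. b (Suc n) \<omega> ^ 4) \<le> K ^ 4"
    using abs_monomial_le[of "Suc n" 0 4] by simp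
  ultimately have "expectation (\<lambda>\<omega>. B (Suc n) \<omega> ^ 4) \<le> 3 * K ^ 4 * real n ^ 2 + 6 * (real n * K ^ 4) + K ^ 4"
    unfolding eq using Suc by (simp add: integ bounded)
  \<comment> \<open>The constant 3 is chosen so that the increment of \<open>3 * n ^ 2\<close>,
    namely \<open>6 * n + 3\<close>, dominates \<open>6 * n + 1\<close>.\<close>
  also have "\<dots> \<le> 3 * K ^ 4 * real (Suc n) ^ 2"
    by (simp add: algebra_simps power2_eq_square)
  finally show ?case .
qed

end

section \<open>Exchange of the two sequences and expansion of the ratio\<close>

context centered_indep_pairs
begin

text \<open>The assumptions are symmetric in \<open>a\<close> and \<open>b\<close>, so bounds proved
  for \<open>B\<close> hold for \<open>A\<close> as well.\<close>

interpretation swap: centered_indep_pairs M b a c K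
proof
  have "indep_vars (\<lambda>_. borel) (\<lambda>i \<omega>. prod.swap (a i \<omega>, b i \<omega>)) UNIV"
    by (rule indep_vars_compose2[OF indep])
       (auto simp: prod.swap_def intro!: borel_measurable_continuous_onI continuous_intros)
  then show "indep_vars (\<lambda>_. borel) (\<lambda>i \<omega>. (b i \<omega>, a i \<omega>)) UNIV"
    by simp
qed (use a_le b_le mean_a mean_b cov in \<open>auto simp: mult.commute\<close>)

lemma expectation_A4: "expectation (\<lambda>\<omega>. A n \<omega> ^ 4) \<le> 3 * K ^ 4 * real n ^ 2"
  using swap.expectation_B4 by (simp add: A_def swap.B_def)

lemma expectation_AB3: "\<bar>expectation (\<lambda>\<omega>. A n \<omega> * B n \<omega> ^ 3)\<bar> \<le> 6 * K ^ 4 * real n ^ 2"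
proof -
  have "\<bar>expectation (\<lambda>\<omega>. A n \<omega> * B n \<omega> ^ 3)\<bar> \<le> expectation (\<lambda>\<omega>. \<bar>A n \<omega> * B n \<omega> ^ 3\<bar>)"
    by (rule integral_abs_bound)
  also have "\<dots> \<le> expectation (\<lambda>\<omega>. A n \<omega> ^ 4 + B n \<omega> ^ 4)"
    by (intro integral_mono integrable_abs integ bounded) (rule abs_mult_cube_le)
  also have "\<dots> \<le> 6 * K ^ 4 * real n ^ 2"
    using expectation_A4[of n] expectation_B4[of n] by (simp add: integ bounded)
  finally show ?thesis .
qed

text \<open>The denominator stands for the sum of the weights. Assumption \<open>le\<close> bounds
  the quotient itself, which allows the quotient to stay inside the remainder of the expansion. In
  the bound, \<open>K ^ 3\<close> comes from the moment of \<open>A\<close> and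
  \<open>B ^ 2\<close>, the 6 from that of \<open>A\<close> and \<open>B ^ 3\<close>, and
  \<open>3 * L\<close> from the remainder.\<close>

lemma expectation_ratio:
  assumes pos: "AE \<omega> in M. 0 < real n * \<mu> + B n \<omega>"
    and le: "AE \<omega> in M. \<bar>A n \<omega>\<bar> \<le> L * (real n * \<mu> + B n \<omega>)"
    and "\<mu> > 0" "n \<ge> 1" "L \<ge> 0"
  shows "\<bar>expectation (\<lambda>\<omega>. A n \<omega> / (real n * \<mu> + B n \<omega>)) + c / (real n * \<mu> ^ 2)\<bar>
    \<le> (K ^ 3 / \<mu> ^ 3 + (6 + 3 * L) * K ^ 4 / \<mu> ^ 4) / real n ^ 2"
proof -
  define m where "m = real n * \<mu>"
  have m: "m > 0" using assms by (simp add: m_def)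
  define R where "R \<omega> = A n \<omega> / (m + B n \<omega>)" for \<omega>
  have [measurable]: "A n \<in> borel_measurable M" "B n \<in> borel_measurable M"
    using ess_bounded_A[of n] ess_bounded_B[of n] by (simp_all add: ess_bounded_def)
  have R_le: "AE \<omega> in M. \<bar>R \<omega>\<bar> \<le> L"
    using pos le by eventually_elim (simp add: R_def m_def field_simps)
  have R: "ess_bounded R"
    using R_le
    by (rule ess_boundedI[rotated])
       (simp add: R_def[abs_def])
  have [measurable]: "R \<in> borel_measurable M"
    using R by (simp add: ess_bounded_def)
  let ?R4 = "\<lambda>\<omega>. R \<omega> * B n \<omega> ^ 4"
  have R4: "ess_bounded ?R4" by (intro bounded R)
  \<comment> \<open>An exact finite geometric expansion of \<open>1 / (m + B)\<close>, with
    \<open>R\<close> reappearing in the last term; no smallness of \<open>B / m\<close> is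
    involved.\<close>
  have "AE \<omega> in M. R \<omega> = A n \<omega> / m - A n \<omega> * B n \<omega> / m ^ 2 + A n \<omega> * B n \<omega> ^ 2 / m ^ 3
      - A n \<omega> * B n \<omega> ^ 3 / m ^ 4 + ?R4 \<omega> / m ^ 4"
    using pos
  proof eventually_elim
    case (elim \<omega>)
    define s where "s = m + B n \<omega>"
    have "s > 0" using elim by (simp add: s_def m_def)
    \<comment> \<open>This is \<open>A\<close> times the factorization of
      \<open>m ^ 4 - B ^ 4\<close> with factor \<open>m + B\<close>.\<close>
    have "A n \<omega> * m ^ 4 = s * (A n \<omega> * m ^ 3 - A n \<omega> * B n \<omega> * m ^ 2 + A n \<omega> * B n \<omega> ^ 2 * m
        - A n \<omega> * B n \<omega> ^ 3) + A n \<omega> * B n \<omega> ^ 4"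
      unfolding s_def by algebra
    then have "A n \<omega> / s = (A n \<omega> * m ^ 3 - A n \<omega> * B n \<omega> * m ^ 2 + A n \<omega> * B n \<omega> ^ 2 * m
        - A n \<omega> * B n \<omega> ^ 3 + A n \<omega> / s * B n \<omega> ^ 4) / m ^ 4"
      using \<open>s > 0\<close> m by (simp add: field_simps)
    also have "\<dots> = A n \<omega> / m - A n \<omega> * B n \<omega> / m ^ 2 + A n \<omega> * B n \<omega> ^ 2 / m ^ 3
        - A n \<omega> * B n \<omega> ^ 3 / m ^ 4 + A n \<omega> / s * B n \<omega> ^ 4 / m ^ 4"
      using m by (simp add: add_divide_distrib diff_divide_distrib power2_eq_square power3_eq_cube power4_eq_xxxx)
    finally show ?case unfolding R_def s_def .
  qed
  then have "expectation R = expectation (\<lambda>\<omega>. A n \<omega> / m - A n \<omega> * B n \<omega> / m ^ 2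
      + A n \<omega> * B n \<omega> ^ 2 / m ^ 3 - A n \<omega> * B n \<omega> ^ 3 / m ^ 4 + ?R4 \<omega> / m ^ 4)"
    by (intro integral_cong_AE) simp_all
  \<comment> \<open>The first-order term drops out as \<open>A\<close> is centered; the second one
    is exactly the leading bias.\<close>
  also have "\<dots> = - (real n * c / m ^ 2) + expectation (\<lambda>\<omega>. A n \<omega> * B n \<omega> ^ 2) / m ^ 3
      - expectation (\<lambda>\<omega>. A n \<omega> * B n \<omega> ^ 3) / m ^ 4 + expectation ?R4 / m ^ 4"
    by (simp add: integ bounded R4 mean_A expectation_AB)
  finally have "expectation R + real n * c / m ^ 2 = expectation (\<lambda>\<omega>. A n \<omega> * B n \<omega> ^ 2) / m ^ 3
      - expectation (\<lambda>\<omega>. A n \<omega> * B n \<omega> ^ 3) / m ^ 4 + expectation ?R4 / m ^ 4" (is "_ = ?r")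
    by simp
  moreover have "real n * c / m ^ 2 = c / (real n * \<mu> ^ 2)"
    using assms by (simp add: m_def power2_eq_square)
  moreover have "\<bar>?r\<bar> \<le> real n * K ^ 3 / m ^ 3 + 6 * K ^ 4 * real n ^ 2 / m ^ 4 + L * (3 * K ^ 4 * real n ^ 2) / m ^ 4"
  proof -
    have "\<bar>expectation ?R4\<bar> \<le> expectation (\<lambda>\<omega>. \<bar>?R4 \<omega>\<bar>)"
      by (rule integral_abs_bound)
    also have "\<dots> \<le> expectation (\<lambda>\<omega>. L * B n \<omega> ^ 4)"
      using R_le
      by (intro integral_mono_AE integrable_abs integ bounded R)
         (auto elim!: eventually_mono simp: abs_mult intro!: mult_right_mono)
    also have "\<dots> \<le> L * (3 * K ^ 4 * real n ^ 2)"
      using expectation_B4[of n] \<open>L \<ge> 0\<close> by (simp add: integ bounded mult_left_mono)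
    finally have "\<bar>expectation ?R4 / m ^ 4\<bar> \<le> L * (3 * K ^ 4 * real n ^ 2) / m ^ 4"
      using m by (simp add: divide_right_mono)
    moreover have "\<bar>expectation (\<lambda>\<omega>. A n \<omega> * B n \<omega> ^ 2) / m ^ 3\<bar> \<le> real n * K ^ 3 / m ^ 3"
      using expectation_AB2[of n] m by (simp add: divide_right_mono)
    moreover have "\<bar>expectation (\<lambda>\<omega>. A n \<omega> * B n \<omega> ^ 3) / m ^ 4\<bar> \<le> 6 * K ^ 4 * real n ^ 2 / m ^ 4"
      using expectation_AB3[of n] m by (simp add: divide_right_mono)
    ultimately show ?thesis by linarith
  qed
  \<comment> \<open>With \<open>m = n * \<mu>\<close>, both \<open>n / m ^ 3\<close> and
    \<open>n ^ 2 / m ^ 4\<close> are of order \<open>n\<close> to the power -2.\<close>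
  moreover have "real n * K ^ 3 / m ^ 3 + 6 * K ^ 4 * real n ^ 2 / m ^ 4 + L * (3 * K ^ 4 * real n ^ 2) / m ^ 4
      = (K ^ 3 / \<mu> ^ 3 + (6 + 3 * L) * K ^ 4 / \<mu> ^ 4) / real n ^ 2"
    using assms by (simp add: m_def field_simps power_mult_distrib power2_eq_square power3_eq_cube power4_eq_xxxx)
  ultimately show ?thesis
    unfolding R_def m_def by simp
qed

end

section \<open>The bias of the minibatch centroid, coordinate by coordinate\<close>

theorem theorem3p3:
  fixes p :: "(real ^ 'd) measure"
    and k :: "real ^ 'd \<Rightarrow> real ^ 'd \<Rightarrow> real"
    and x :: "real ^ 'd"
    and P :: "'w measure"
    and y :: "'w \<Rightarrow> real ^ 'd"
    and Y :: "nat \<Rightarrow> 'w \<Rightarrow> real ^ 'd"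
    and M C :: real
  assumes "prob_space p" and "sets p = sets borel"
    and "k x \<in> borel_measurable borel"
    and "prob_space P"
    and "prob_space.indep_vars P (\<lambda>_. borel) (Y(0 := y)) UNIV"
    and "distr P borel y = p" and "\<And>i. i \<ge> 1 \<Longrightarrow> distr P borel (Y i) = p"
    and "M > 0" and "C > 0"
    and "AE \<omega> in P. k x (y \<omega>) \<in> {0..M}"
    and "AE \<omega> in P. norm (y \<omega>) \<le> C"
    and "\<P>(\<omega> in P. k x (y \<omega>) > 0) = 1"
    and "(\<integral>\<omega>. k x (y \<omega>) \<partial>P) > 0"
  shows "(\<lambda>n. norm
           (((\<integral>\<omega>. minibatch_centroid k x (\<lambda>i. Y i \<omega>) n \<partial>P) - target_centroid P k x y)
            - (- (1 / real n) *\<^sub>R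
                 ((\<integral>\<omega>. (k x (y \<omega>))\<^sup>2 *\<^sub>R (y \<omega> - target_centroid P k x y) \<partial>P)
                   /\<^sub>R (\<integral>\<omega>. k x (y \<omega>) \<partial>P)\<^sup>2))))
         \<in> O(\<lambda>n. 1 / real n ^ 2)"
proof -
  interpret P: prob_space P by fact
  \<comment> \<open>One i.i.d. sequence with the reference variable \<open>y\<close> at index 0; the
    samples entering the centroid are those of index at least 1.\<close>
  define V where "V = Y(0 := y)"
  define \<mu> where "\<mu> = (\<integral>\<omega>. k x (y \<omega>) \<partial>P)"
  define \<tau> where "\<tau> = target_centroid P k x y"
  define q where "q = (\<integral>\<omega>. (k x (y \<omega>))\<^sup>2 *\<^sub>R (y \<omega> - \<tau>) \<partial>P)"
  define T where "T n \<omega> = minibatch_centroid k x (\<lambda>i. Y i \<omega>) n" for n \<omega>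
  have "\<mu> > 0" using assms unfolding \<mu>_def by simp
  note [measurable] = \<open>k x \<in> borel_measurable borel\<close>
  have [measurable]: "(\<lambda>v :: real ^ 'd. v $ j) \<in> borel_measurable borel" for j
    by (intro borel_measurable_continuous_onI continuous_intros)
  have V_meas [measurable]: "V i \<in> borel_measurable P" for i
    using assms(5) by (auto simp: P.indep_vars_def V_def)
  have y_eq: "y = V 0" and Y_eq: "i \<ge> 1 \<Longrightarrow> Y i = V i" for i
    by (auto simp: V_def)
  have [measurable]: "y \<in> borel_measurable P"
    using V_meas[of 0] by (simp add: V_def)
  have V_distr: "distr P borel (V i) = distr P borel y" for i
    using assms(6,7) by (cases "i = 0") (auto simp: V_def)
  \<comment> \<open>Moments are computed for \<open>y\<close> alone and carried to each
    \<open>V i\<close> through the common law; \<open>V_AE\<close> does the same for almost sure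
    properties.\<close>
  have V_int: "(\<integral>\<omega>. f (V i \<omega>) \<partial>P) = (\<integral>\<omega>. f (y \<omega>) \<partial>P)"
    if [measurable]: "f \<in> borel_measurable borel" for f :: "real ^ 'd \<Rightarrow> real" and i
    using integral_distr[of "V i" P borel f] integral_distr[of y P borel f]
    by (simp add: V_distr)
  have V_AE: "AE \<omega> in P. Q (V i \<omega>)"
    if [measurable]: "Measurable.pred borel Q" and ae: "AE \<omega> in P. Q (y \<omega>)" for Q :: "real ^ 'd \<Rightarrow> bool" and i
    using AE_distr_iff[of "V i" P borel Q] AE_distr_iff[of y P borel Q] ae
    unfolding V_distr by simp
  have w_le: "AE \<omega> in P. k x (V i \<omega>) \<le> M" for i
    by (rule V_AE) (use assms(10) in auto)
  have V_le: "AE \<omega> in P. norm (V i \<omega>) \<le> C" for i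
    by (rule V_AE) (use assms(11) in auto)
  have w_pos: "AE \<omega> in P. 0 < k x (V i \<omega>)" for i
  proof (rule V_AE)
    show "AE \<omega> in P. 0 < k x (y \<omega>)"
      using assms(12) P.prob_Collect_eq_1[of "\<lambda>\<omega>. k x (y \<omega>) > 0"] by (simp add: y_eq)
  qed simp
  have V_AE_all: "AE \<omega> in P. 0 < k x (V i \<omega>) \<and> k x (V i \<omega>) \<le> M \<and> norm (V i \<omega>) \<le> C" for i
    using w_pos w_le V_le by simp
  \<comment> \<open>Countably many indices share a single null set, so the sums can be estimated
    pointwise outside it.\<close>
  then have all: "AE \<omega> in P. \<forall>i. 0 < k x (V i \<omega>) \<and> k x (V i \<omega>) \<le> M \<and> norm (V i \<omega>) \<le> C"
    by (subst AE_all_countable) blast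
  have T_eq: "T n \<omega> = (\<Sum>i=1..n. (k x (V i \<omega>) / (\<Sum>j=1..n. k x (V j \<omega>))) *\<^sub>R V i \<omega>)" for n \<omega>
    by (simp add: T_def minibatch_centroid_def Y_eq)
  have T_int: "integrable P (T n)" for n
  proof (rule P.integrable_const_bound)
    \<comment> \<open>Each coefficient is at most 1. This crude bound, growing with
      \<open>n\<close>, serves only integrability.\<close>
    show "AE \<omega> in P. norm (T n \<omega>) \<le> real n * C"
      using all
    proof eventually_elim
      case (elim \<omega>)
      have "norm (T n \<omega>) \<le> (\<Sum>i=1..n. C)"
        unfolding T_eq
      proof (rule sum_norm_le)
        fix i assume i: "i \<in> {1..n}"
        let ?S = "\<Sum>j=1..n. k x (V j \<omega>)"
        have "k x (V i \<omega>) \<le> ?S"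
          using i elim by (intro member_le_sum) (auto intro: less_imp_le)
        moreover have "0 < k x (V i \<omega>)" using elim by blast
        ultimately have "\<bar>k x (V i \<omega>) / ?S\<bar> \<le> 1" by simp
        then have "\<bar>k x (V i \<omega>) / ?S\<bar> * norm (V i \<omega>) \<le> 1 * C"
          using elim by (intro mult_mono) auto
        then show "norm ((k x (V i \<omega>) / ?S) *\<^sub>R V i \<omega>) \<le> C" by simp
      qed
      then show ?case by simp
    qed
    show "T n \<in> borel_measurable P"
      unfolding T_eq[abs_def] by measurable
  qed
  note bd_int = P.integrable_compose_bounded[OF V_AE_all[of 0, folded y_eq] \<open>y \<in> borel_measurable P\<close>]

  have "\<exists>D. \<forall>n\<ge>1. \<bar>((\<integral>\<omega>. T n \<omega> \<partial>P) - \<tau> - (- (1 / real n) *\<^sub>R (q /\<^sub>R \<mu>\<^sup>2))) $ j\<bar> \<le> D / real n ^ 2" for j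
  proof -
    define a where "a i \<omega> = k x (V i \<omega>) * (V i \<omega> $ j - \<tau> $ j)" for i \<omega>
    define b where "b i \<omega> = k x (V i \<omega>) - \<mu>" for i \<omega>
    define L where "L = C + \<bar>\<tau> $ j\<bar>"
    \<comment> \<open>The two entries bound \<open>a i\<close> and \<open>b i\<close> respectively,
      \<open>L\<close> being a bound for the deviation of a sample coordinate from the
      target.\<close>
    define K where "K = max (M * L) (M + \<bar>\<mu>\<bar>)"
    have L: "\<bar>v $ j - \<tau> $ j\<bar> \<le> L" if "norm v \<le> C" for v
      using component_le_norm_cart[of v j] that by (simp add: L_def)
    have wv_int: "integrable P (\<lambda>\<omega>. k x (y \<omega>) *\<^sub>R y \<omega>)"
      by (rule bd_int[where D = "M * C"]) (auto intro!: mult_mono)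
    have w_int: "integrable P (\<lambda>\<omega>. k x (y \<omega>))"
      by (rule bd_int[where D = M]) auto
    \<comment> \<open>The target centroid is precisely the point about which the weighted deviation
      has mean zero.\<close>
    have aa: "(\<integral>\<omega>. k x (y \<omega>) * (y \<omega> $ j - \<tau> $ j) \<partial>P) = 0"
    proof -
      have "(\<integral>\<omega>. k x (y \<omega>) * (y \<omega> $ j - \<tau> $ j) \<partial>P) = (\<integral>\<omega>. (k x (y \<omega>) *\<^sub>R y \<omega>) $ j - k x (y \<omega>) * \<tau> $ j \<partial>P)"
        by (simp add: algebra_simps)
      also have "\<dots> = (\<integral>\<omega>. (k x (y \<omega>) *\<^sub>R y \<omega>) $ j \<partial>P) - \<mu> * \<tau> $ j"
        unfolding \<mu>_def using integrable_bounded_linear[OF bounded_linear_vec_nth wv_int] w_int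
        by (subst Bochner_Integration.integral_diff) auto
      also have "(\<integral>\<omega>. (k x (y \<omega>) *\<^sub>R y \<omega>) $ j \<partial>P) = (\<integral>\<omega>. k x (y \<omega>) *\<^sub>R y \<omega> \<partial>P) $ j"
        by (rule integral_bounded_linear[OF bounded_linear_vec_nth wv_int])
      also have "\<dots> = \<mu> * \<tau> $ j"
        using \<open>\<mu> > 0\<close> by (simp add: \<tau>_def target_centroid_def \<mu>_def)
      finally show ?thesis by simp
    qed
    have qj: "q $ j = (\<integral>\<omega>. k x (y \<omega>) * (k x (y \<omega>) * (y \<omega> $ j - \<tau> $ j)) \<partial>P)"
    proof -
      have "integrable P (\<lambda>\<omega>. (k x (y \<omega>))\<^sup>2 *\<^sub>R (y \<omega> - \<tau>))"
        by (rule bd_int[where D = "M\<^sup>2 * (C + norm \<tau>)"])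
           (auto intro!: mult_mono power_mono norm_triangle_le_diff)
      from integral_bounded_linear[OF bounded_linear_vec_nth[of j] this] show ?thesis
        by (simp add: q_def power2_eq_square mult.assoc)
    qed
    have wa_int: "integrable P (\<lambda>\<omega>. k x (y \<omega>) * (y \<omega> $ j - \<tau> $ j))"
      using L by (intro bd_int[where D = "M * L"]) (auto simp: abs_mult intro!: mult_mono)
    have wwa_int: "integrable P (\<lambda>\<omega>. k x (y \<omega>) * (k x (y \<omega>) * (y \<omega> $ j - \<tau> $ j)))"
      using L \<open>M > 0\<close> by (intro bd_int[where D = "M * (M * L)"]) (auto simp: abs_mult intro!: mult_mono)
    interpret pairs: centered_indep_pairs P a b "q $ j" K
    proof
      show "P.indep_vars (\<lambda>_. borel) (\<lambda>i \<omega>. (a i \<omega>, b i \<omega>)) UNIV"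
        unfolding a_def b_def
        by (rule P.indep_vars_compose2[OF assms(5)[folded V_def], where Y = "\<lambda>_ v. (k x v * (v $ j - \<tau> $ j), k x v - \<mu>)"]) measurable
      show "AE \<omega> in P. \<bar>a i \<omega>\<bar> \<le> K" for i
        using all
      proof eventually_elim
        case (elim \<omega>)
        then have "\<bar>a i \<omega>\<bar> \<le> M * L"
          using L[of "V i \<omega>"] \<open>M > 0\<close> unfolding a_def abs_mult
          by (intro mult_mono) (auto simp: abs_of_pos)
        then show ?case by (simp add: K_def)
      qed
      show "AE \<omega> in P. \<bar>b i \<omega>\<bar> \<le> K" for i
        using all
      proof eventually_elim
        case (elim \<omega>)
        then have "0 < k x (V i \<omega>)" "k x (V i \<omega>) \<le> M" by auto
        then show ?case by (simp add: K_def b_def)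
      qed
      show "P.expectation (a i) = 0" for i
        unfolding a_def using V_int[of "\<lambda>v. k x v * (v $ j - \<tau> $ j)" i] aa by simp
      show "P.expectation (b i) = 0" for i
        unfolding b_def using V_int[of "\<lambda>v. k x v - \<mu>" i] w_int by (simp add: \<mu>_def P.prob_space)
      \<comment> \<open>Subtracting \<open>\<mu>\<close> from the weight costs only
        \<open>\<mu>\<close> times the mean in \<open>aa\<close>, which is zero; the covariance is
        thus the numerator of the claimed leading term.\<close>
      show "P.expectation (\<lambda>\<omega>. a i \<omega> * b i \<omega>) = q $ j" for i
      proof -
        have "P.expectation (\<lambda>\<omega>. a i \<omega> * b i \<omega>) =
            (\<integral>\<omega>. k x (y \<omega>) * (y \<omega> $ j - \<tau> $ j) * (k x (y \<omega>) - \<mu>) \<partial>P)"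
          unfolding a_def b_def by (rule V_int) measurable
        also have "\<dots> = (\<integral>\<omega>. k x (y \<omega>) * (k x (y \<omega>) * (y \<omega> $ j - \<tau> $ j)) - \<mu> * (k x (y \<omega>) * (y \<omega> $ j - \<tau> $ j)) \<partial>P)"
          by (simp add: algebra_simps)
        also have "\<dots> = q $ j"
          by (subst Bochner_Integration.integral_diff) (use wa_int wwa_int aa qj in auto)
        finally show ?thesis .
      qed
    qed
    have S_eq: "real n * \<mu> + pairs.B n \<omega> = (\<Sum>i=1..n. k x (V i \<omega>))" for n \<omega>
      by (simp add: pairs.B_def b_def sum_subtractf)
    have bound: "\<bar>((\<integral>\<omega>. T n \<omega> \<partial>P) - \<tau> - (- (1 / real n) *\<^sub>R (q /\<^sub>R \<mu>\<^sup>2))) $ j\<bar>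
        \<le> (K ^ 3 / \<mu> ^ 3 + (6 + 3 * L) * K ^ 4 / \<mu> ^ 4) / real n ^ 2" if n: "n \<ge> 1" for n
    proof -
      let ?S = "\<lambda>\<omega>. \<Sum>i=1..n. k x (V i \<omega>)"
      have pos: "AE \<omega> in P. 0 < ?S \<omega>"
        using all n by (auto elim!: eventually_mono intro!: sum_pos)
      \<comment> \<open>Convexity in disguise: the triangle inequality bounds the weighted sum of
        deviations by \<open>L\<close> times the total weight.\<close>
      have A_le: "AE \<omega> in P. \<bar>pairs.A n \<omega>\<bar> \<le> L * ?S \<omega>"
        using all
      proof eventually_elim
        case (elim \<omega>)
        have "\<bar>a i \<omega>\<bar> \<le> L * k x (V i \<omega>)" for i
          using elim L[of "V i \<omega>"] by (auto simp: a_def abs_mult abs_of_pos mult.commute intro: mult_left_mono)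
        then show ?case
          unfolding pairs.A_def sum_distrib_left by (intro order.trans[OF sum_abs] sum_mono)
      qed
      \<comment> \<open>Since the normalized weights sum to 1, \<open>\<tau>\<close> can be moved
        inside the weighted average.\<close>
      have ae: "AE \<omega> in P. T n \<omega> $ j = \<tau> $ j + pairs.A n \<omega> / ?S \<omega>"
        using pos
      proof eventually_elim
        case (elim \<omega>)
        have "pairs.A n \<omega> = (\<Sum>i=1..n. k x (V i \<omega>) * V i \<omega> $ j) - ?S \<omega> * \<tau> $ j"
          by (simp add: pairs.A_def a_def algebra_simps sum_subtractf sum_distrib_left)
        moreover have "T n \<omega> $ j = (\<Sum>i=1..n. k x (V i \<omega>) * V i \<omega> $ j) / ?S \<omega>"
          by (simp add: T_eq sum_divide_distrib)
        ultimately show ?case using elim by (simp add: field_simps)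
      qed
      have [measurable]: "pairs.A n \<in> borel_measurable P"
        using pairs.ess_bounded_A[of n] by (simp add: P.ess_bounded_def)
      have int: "integrable P (\<lambda>\<omega>. T n \<omega> $ j)"
        by (rule integrable_bounded_linear[OF bounded_linear_vec_nth T_int])
      have "(\<integral>\<omega>. pairs.A n \<omega> / ?S \<omega> \<partial>P) = (\<integral>\<omega>. T n \<omega> $ j - \<tau> $ j \<partial>P)"
        using ae int by (intro integral_cong_AE) (auto elim!: eventually_mono)
      also have "\<dots> = (\<integral>\<omega>. T n \<omega> \<partial>P) $ j - \<tau> $ j"
        using int integral_bounded_linear[OF bounded_linear_vec_nth T_int] by (simp add: P.prob_space)
      finally have "(\<integral>\<omega>. T n \<omega> \<partial>P) $ j - \<tau> $ j = (\<integral>\<omega>. pairs.A n \<omega> / ?S \<omega> \<partial>P)" ..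
      moreover have "0 \<le> L" using \<open>C > 0\<close> by (simp add: L_def)
      ultimately show ?thesis
        using pairs.expectation_ratio[of n \<mu> L, unfolded S_eq, OF pos A_le \<open>\<mu> > 0\<close> n]
        by (simp add: divide_inverse algebra_simps)
    qed
    then show ?thesis by blast
  qed
  then obtain D where D: "\<And>j n. n \<ge> 1 \<Longrightarrow>
      \<bar>((\<integral>\<omega>. T n \<omega> \<partial>P) - \<tau> - (- (1 / real n) *\<^sub>R (q /\<^sub>R \<mu>\<^sup>2))) $ j\<bar> \<le> D j / real n ^ 2"
    by metis
  have "norm ((\<integral>\<omega>. T n \<omega> \<partial>P) - \<tau> - (- (1 / real n) *\<^sub>R (q /\<^sub>R \<mu>\<^sup>2))) \<le> (\<Sum>j\<in>UNIV. D j) * (1 / real n ^ 2)"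
    if "n \<ge> 1" for n
  proof -
    \<comment> \<open>The Euclidean norm is at most the sum of the absolute coordinates, so the
      finitely many constants \<open>D j\<close> add up to one that is independent of
      \<open>n\<close>.\<close>
    have "norm ((\<integral>\<omega>. T n \<omega> \<partial>P) - \<tau> - (- (1 / real n) *\<^sub>R (q /\<^sub>R \<mu>\<^sup>2))) \<le> (\<Sum>j\<in>UNIV. D j / real n ^ 2)"
      by (rule order.trans[OF norm_le_l1_cart sum_mono]) (rule D[OF that])
    then show ?thesis by (simp add: sum_divide_distrib)
  qed
  then show ?thesis
    unfolding T_def q_def \<tau>_def \<mu>_def
    by (intro bigoI[where c = "\<Sum>j\<in>UNIV. D j"] eventually_sequentiallyI[of 1]) simp
qed

end
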